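(* Let $G$ be a second countable topological group with a generating probability measure $\mu$, and let $\Gamma$ be an open, recurrent subgroup of $(G,\mu)$. Then the expected return time $\mathbb{E}[\tau]$ of the $\mu$-random walk to $\Gamma$ is equal to the index of $\Gamma$ in $G$: $$\mathbb{E}[\tau]=[G:\Gamma]$$ (both sides may be infinite).
   Context: Here $\mu$ is a Borel probability measure on $G$. Its support is $\operatorname{supp}(\mu)=\{g\in G : \mu(A)>0 \text{ for any open } A\ni g\}$, and $\mu$ is generating if the semigroup generated by $\operatorname{supp}(\mu)$ is the whole of $G$. Let $X_1,X_2,\ldots$ be i.i.d. $G$-valued random variables with law $\mu$, and $Z_n=X_1X_2\cdots X_n$ (the $\mu$-random walk on $G$ started at the identity). The subgroup $\Gamma$ is recurrent for $(G,\mu)$ if almost surely there exists $n\ge 1$ with $Z_n\in\Gamma$ (equivalently, almost surely $Z_n\in\Gamma$ for infinitely many $n$). The return time is $\tau=\min\{n\ge 1 : Z_n\in\Gamma\}$, defined almost surely, and $\mathbb{E}[\tau]\in[1,\infty]$ is its expectation. When $[G:\Gamma]$ is infinite, it is read as $\infty$. *)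

theory Defs
  imports "HOL-Probability.Probability"
begin

text \<open>
  A topological group is a type of class \<open>topological_group_add\<close>. This class does not assume
  commutativity (nor the Hausdorff property); the group law is merely written additively:
  \<open>g + h\<close> is the product, \<open>- g\<close> the inverse and \<open>0\<close> the identity element.
\<close>

definition is_subgroup :: "'g::group_add set \<Rightarrow> bool" where
  "is_subgroup H \<longleftrightarrow>
     0 \<in> H \<and> (\<forall>a\<in>H. \<forall>b\<in>H. a + b \<in> H) \<and> (\<forall>a\<in>H. - a \<in> H)"

definition left_cosets :: "'g::group_add set \<Rightarrow> 'g set set" where
  "left_cosets H = range (\<lambda>g. (\<lambda>h. g + h) ` H)"

text \<open>No distinction is made between infinite cardinalities: an infinite index is \<open>\<infinity>\<close>.\<close>

definition subgroup_index :: "'g::group_add set \<Rightarrow> ennreal" where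
  "subgroup_index H =
     (if finite (left_cosets H) then of_nat (card (left_cosets H)) else \<infinity>)"

definition measure_support :: "'g::topological_space measure \<Rightarrow> 'g set" where
  "measure_support \<mu> = {g. \<forall>A. open A \<and> g \<in> A \<longrightarrow> emeasure \<mu> A > 0}"

text \<open>The semigroup generated by a set: neither the identity nor inverses are added.\<close>

inductive_set generated_semigroup :: "'g::semigroup_add set \<Rightarrow> 'g set"
  for S :: "'g set" where
  base: "s \<in> S \<Longrightarrow> s \<in> generated_semigroup S"
| mult: "a \<in> generated_semigroup S \<Longrightarrow> b \<in> generated_semigroup S \<Longrightarrow>
         a + b \<in> generated_semigroup S"

definition generating :: "'g::{topological_space, semigroup_add} measure \<Rightarrow> bool" where
  "generating \<mu> \<longleftrightarrow> generated_semigroup (measure_support \<mu>) = UNIV"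

text \<open>
  The steps are indexed from 1, so \<open>X 0\<close> is irrelevant. New steps are multiplied on the right:
  \<open>walk X n \<omega>\<close> is \<open>X 1 \<omega> + X 2 \<omega> + \<dots> + X n \<omega>\<close>.
\<close>

primrec walk :: "(nat \<Rightarrow> 'w \<Rightarrow> 'g::monoid_add) \<Rightarrow> nat \<Rightarrow> 'w \<Rightarrow> 'g" where
  "walk X 0 \<omega> = 0"
| "walk X (Suc n) \<omega> = walk X n \<omega> + X (Suc n) \<omega>"

definition iid_with_law ::
    "'w measure \<Rightarrow> (nat \<Rightarrow> 'w \<Rightarrow> 'g::topological_space) \<Rightarrow> 'g measure \<Rightarrow> bool" where
  "iid_with_law P X \<mu> \<longleftrightarrow>
     prob_space.indep_vars P (\<lambda>_. borel) X {1..} \<and> (\<forall>n\<ge>1. distr P borel (X n) = \<mu>)"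

definition recurrent ::
    "'w measure \<Rightarrow> (nat \<Rightarrow> 'w \<Rightarrow> 'g::monoid_add) \<Rightarrow> 'g set \<Rightarrow> bool" where
  "recurrent P X H \<longleftrightarrow> (AE \<omega> in P. \<exists>n\<ge>1. walk X n \<omega> \<in> H)"

text \<open>
  When the walk never returns to \<open>H\<close>, the value is an unspecified natural number; under
  recurrence this concerns a null set only.
\<close>

definition return_time ::
    "(nat \<Rightarrow> 'w \<Rightarrow> 'g::monoid_add) \<Rightarrow> 'g set \<Rightarrow> 'w \<Rightarrow> nat" where
  "return_time X H \<omega> = (LEAST n. n \<ge> 1 \<and> walk X n \<omega> \<in> H)"

end

theory Submission
  imports Defs
begin

text \<open>
  The walk moves on the countable set of right cosets \<open>\<Gamma> g\<close> as an irreducible Markov chain,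
  and counting measure is invariant for it. Let \<open>\<nu> c\<close> be the expected number of visits to the
  coset \<open>c\<close> before the first return to \<open>\<Gamma>\<close>; summing \<open>\<nu>\<close> over all cosets gives the expected
  return time. Recurrence makes \<open>\<nu>\<close> invariant, and \<open>\<nu> \<le> 1\<close> since \<open>\<nu>\<close> is the minimal solution.
  So \<open>1 - \<nu>\<close> is a nonnegative invariant measure that vanishes at \<open>\<Gamma>\<close>, hence everywhere by
  irreducibility, and the sum of \<open>\<nu>\<close> is the number of cosets.
\<close>

section \<open>Uniqueness of the invariant measure of a recurrent chain\<close>

text \<open>Here \<open>p x y\<close> is the probability of a transition from \<open>x\<close> to
  \<open>y\<close>, and \<open>q n x\<close> that of being at \<open>x\<close> at time
  \<open>n\<close> without a return to \<open>b\<close> at times 1 to \<open>n\<close>.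
  Irreducibility is phrased through sets closed under predecessors because zeros of an invariant
  measure propagate backwards.\<close>

lemma taboo_occupation_eq_1:
  fixes p :: "'c \<Rightarrow> 'c \<Rightarrow> ennreal" and q :: "nat \<Rightarrow> 'c \<Rightarrow> ennreal" and b :: 'c
  assumes col: "\<And>y. y \<in> C \<Longrightarrow> (\<integral>\<^sup>+x. p x y \<partial>count_space C) = 1"
    and b: "b \<in> C"
    and q0: "\<And>y. y \<in> C \<Longrightarrow> q 0 y = (if y = b then 1 else 0)"
    and qSuc: "\<And>n y. y \<in> C \<Longrightarrow>
      q (Suc n) y = (if y = b then 0 else \<integral>\<^sup>+x. q n x * p x y \<partial>count_space C)"
    and return: "(\<integral>\<^sup>+x. (\<Sum>n. q n x) * p x b \<partial>count_space C) = 1"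
    and irreducible: "\<And>D. D \<subseteq> C \<Longrightarrow> b \<in> D \<Longrightarrow>
      (\<And>x y. x \<in> C \<Longrightarrow> y \<in> D \<Longrightarrow> p x y > 0 \<Longrightarrow> x \<in> D) \<Longrightarrow> D = C"
    and y: "y \<in> C"
  shows "(\<Sum>n. q n y) = 1"
proof -
  define \<nu> where "\<nu> y = (\<Sum>n. q n y)" for y
  \<comment> \<open>Minimality of \<nu>: off \<open>b\<close>, one more term of the sum amounts to
    one application of \<open>p\<close>, which preserves the bound 1 because the columns of
    \<open>p\<close> sum to 1.\<close>
  have partial_le: "y \<in> C \<Longrightarrow> (\<Sum>n<N. q n y) \<le> 1" for N y
  proof (induction N arbitrary: y)
    case (Suc N)
    show ?case
    proof (cases "y = b")
      case True
      then show ?thesis using Suc.prems by (simp only: sum.lessThan_Suc_shift qSuc q0) simp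
    next
      case False
      have "(\<Sum>n<Suc N. q n y) = (\<Sum>n<N. \<integral>\<^sup>+x. q n x * p x y \<partial>count_space C)"
        using False Suc.prems by (simp only: sum.lessThan_Suc_shift qSuc q0) simp
      also have "\<dots> = (\<integral>\<^sup>+x. (\<Sum>n<N. q n x) * p x y \<partial>count_space C)"
        by (simp add: nn_integral_sum sum_distrib_right)
      also have "\<dots> \<le> (\<integral>\<^sup>+x. p x y \<partial>count_space C)"
        using Suc.IH by (intro nn_integral_mono) (metis mult_right_mono mult_1 space_count_space zero_le)
      finally show ?thesis using col[OF Suc.prems] by simp
    qed
  qed simp
  have \<nu>_le: "\<nu> y \<le> 1" if "y \<in> C" for y
    unfolding \<nu>_def using partial_le[OF that]
    by (intro suminf_le_const) auto
  have \<nu>_b: "\<nu> b = 1"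
  proof -
    have "\<nu> b = (\<Sum>n. if n = 0 then 1 else 0)"
      unfolding \<nu>_def
    proof (rule suminf_cong)
      show "q n b = (if n = 0 then 1 else 0)" for n
        using b by (cases n) (simp_all add: q0 qSuc)
    qed
    also have "\<dots> = 1"
      by (subst suminf_finite[of "{0}"]) auto
    finally show ?thesis .
  qed
  \<comment> \<open>At \<open>b\<close> this is the hypothesis \<open>return\<close>; elsewhere it
    is the recursion summed over \<open>n\<close>, whose initial term vanishes.\<close>
  have invariant: "(\<integral>\<^sup>+x. \<nu> x * p x y \<partial>count_space C) = \<nu> y" if y: "y \<in> C" for y
  proof (cases "y = b")
    case True
    then show ?thesis using return \<nu>_b by (simp add: \<nu>_def)
  next
    case False
    have "\<nu> y = q 0 y + (\<Sum>n. q (Suc n) y)"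
      unfolding \<nu>_def using suminf_offset[of "\<lambda>n. q n y" 1] by simp
    also have "\<dots> = (\<Sum>n. \<integral>\<^sup>+x. q n x * p x y \<partial>count_space C)"
      using y False by (simp add: q0 qSuc)
    also have "\<dots> = (\<integral>\<^sup>+x. \<nu> x * p x y \<partial>count_space C)"
      by (simp add: \<nu>_def nn_integral_suminf[symmetric])
    finally show ?thesis by simp
  qed
  have "{y\<in>C. \<nu> y = 1} = C"
  proof (rule irreducible)
    fix x y assume x: "x \<in> C" and "y \<in> {y\<in>C. \<nu> y = 1}" and pos: "p x y > 0"
    then have y: "y \<in> C" "\<nu> y = 1" by auto
    \<comment> \<open>Splitting the column sum avoids subtracting integrals in
      \<open>ennreal\<close>: the total and the part belonging to \<nu> both equal 1, and the finite
      1 cancels.\<close>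
    have "1 = (\<integral>\<^sup>+x. (\<nu> x + (1 - \<nu> x)) * p x y \<partial>count_space C)"
    proof -
      have "(\<integral>\<^sup>+x. (\<nu> x + (1 - \<nu> x)) * p x y \<partial>count_space C) = (\<integral>\<^sup>+x. p x y \<partial>count_space C)"
        by (intro nn_integral_cong) (simp add: \<nu>_le add_diff_inverse_ennreal)
      then show ?thesis by (simp add: col y(1))
    qed
    also have "\<dots> = 1 + (\<integral>\<^sup>+x. (1 - \<nu> x) * p x y \<partial>count_space C)"
      using invariant[OF y(1)] y(2) by (simp add: distrib_right nn_integral_add)
    finally have "1 + 0 = 1 + (\<integral>\<^sup>+x. (1 - \<nu> x) * p x y \<partial>count_space C)"
      by (simp only: add_0_right)
    then have "(\<integral>\<^sup>+x. (1 - \<nu> x) * p x y \<partial>count_space C) = 0"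
      unfolding ennreal_add_left_cancel by simp
    then have "(1 - \<nu> x) * p x y = 0"
      using x by (simp add: nn_integral_0_iff_AE AE_count_space)
    then have "1 \<le> \<nu> x"
      using pos by (auto simp: diff_eq_0_iff_ennreal)
    then show "x \<in> {y\<in>C. \<nu> y = 1}"
      using \<nu>_le[OF x] x by auto
  qed (use b \<nu>_b in auto)
  then show ?thesis using y by (auto simp: \<nu>_def)
qed

section \<open>Right cosets\<close>

text \<open>Written as the preimage of \<open>H\<close> under right translation, so that openness
  follows from continuity.\<close>

definition right_coset :: "'g::group_add set \<Rightarrow> 'g \<Rightarrow> 'g set" where
  "right_coset H g = {x. x - g \<in> H}"

lemma right_coset_0 [simp]: "right_coset H 0 = H"
  by (simp add: right_coset_def)

lemma right_coset_eq_iff: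
  assumes "is_subgroup H"
  shows "right_coset H x = right_coset H y \<longleftrightarrow> x \<in> right_coset H y"
proof
  have "x \<in> right_coset H x"
    using assms by (simp add: right_coset_def is_subgroup_def)
  then show "right_coset H x = right_coset H y \<Longrightarrow> x \<in> right_coset H y" by simp
next
  have *: "z - y \<in> H" if "z - x \<in> H" "x - y \<in> H" for x y z
    using assms that unfolding is_subgroup_def
    by (metis add_diff_eq diff_add_cancel)
  have sym: "y - x \<in> H" if "x - y \<in> H"
    using assms that unfolding is_subgroup_def by (metis minus_diff_eq)
  assume "x \<in> right_coset H y"
  then show "right_coset H x = right_coset H y"
    using * sym unfolding right_coset_def by blast
qed

lemma right_coset_eq_self_iff:
  "is_subgroup H \<Longrightarrow> right_coset H x = H \<longleftrightarrow> x \<in> H"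
  using right_coset_eq_iff[of H x 0] by simp

text \<open>A common right factor cancels in the difference, so right translation acts on right
  cosets. This makes the coset of the walk a Markov chain.\<close>

lemma right_coset_add:
  assumes "is_subgroup H" and "right_coset H x = right_coset H y"
  shows "right_coset H (x + s) = right_coset H (y + s)"
proof -
  have "x + s - (y + s) = x - y"
    by (simp add: diff_add_eq_diff_diff_swap)
  then show ?thesis
    using assms by (simp add: right_coset_eq_iff) (simp add: right_coset_def)
qed

text \<open>Inversion maps the right coset of \<open>g\<close> onto the left coset of
  \<open>- g\<close>, a bijection between the two kinds of cosets. Counting measure is \<infinity>
  on every infinite set, as the index is.\<close>

lemma subgroup_index_eq_right_cosets:
  assumes "is_subgroup H"
  shows "subgroup_index H = emeasure (count_space UNIV) (range (right_coset H))"
proof -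
  have "(`) uminus ` range (right_coset H) = left_cosets H"
  proof -
    have "uminus ` right_coset H g = (\<lambda>h. - g + h) ` H" for g
    proof (intro set_eqI iffI)
      fix x assume "x \<in> uminus ` right_coset H g"
      then have "- (- x - g) \<in> H"
        using assms by (auto simp: right_coset_def is_subgroup_def)
      then have "g + x \<in> H" by simp
      then show "x \<in> (\<lambda>h. - g + h) ` H"
        by (rule rev_image_eqI) simp
    next
      fix x assume "x \<in> (\<lambda>h. - g + h) ` H"
      then obtain h where h: "h \<in> H" "x = - g + h" by auto
      have "- x = - h + g" using h by (simp add: minus_add)
      then have "- x \<in> right_coset H g"
        using assms h by (simp add: right_coset_def is_subgroup_def)
      then show "x \<in> uminus ` right_coset H g"
        by (rule rev_image_eqI) simp
    qed
    then have "(`) uminus ` range (right_coset H) = range (\<lambda>g. (\<lambda>h. - g + h) ` H)"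
      by (simp add: image_image)
    also have "\<dots> = (\<lambda>g. (\<lambda>h. g + h) ` H) ` range uminus"
      by (simp only: image_image)
    also have "range uminus = (UNIV :: 'a set)"
      by (rule surjI[of _ uminus]) simp
    finally show ?thesis by (simp add: left_cosets_def)
  qed
  moreover have "inj_on ((`) uminus) (range (right_coset H))"
    by (rule inj_onI) (simp add: inj_image_eq_iff)
  ultimately have "bij_betw ((`) uminus) (range (right_coset H)) (left_cosets H)"
    by (simp add: bij_betw_def)
  then show ?thesis
    using bij_betw_finite bij_betw_same_card
    by (fastforce simp: subgroup_index_def emeasure_count_space)
qed

lemma open_right_coset:
  fixes H :: "'g::topological_group_add set"
  assumes "open H"
  shows "open (right_coset H g)"
proof -
  have "open ((\<lambda>x. x - g) -` H)"
    using assms by (intro open_vimage continuous_intros)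
  then show ?thesis by (simp add: right_coset_def vimage_def)
qed

text \<open>Distinct cosets are disjoint open sets, of which a second countable space has only
  countably many. Countable additivity thus applies to events indexed by cosets.\<close>

lemma countable_right_cosets:
  fixes H :: "'g::{topological_group_add, second_countable_topology} set"
  assumes "is_subgroup H" and "open H"
  shows "countable (range (right_coset H))"
proof (rule countable_disjoint_open_subsets)
  show "pairwise disjnt (range (right_coset H))"
  proof (intro pairwiseI)
    fix c d assume "c \<in> range (right_coset H)" "d \<in> range (right_coset H)" "c \<noteq> d"
    then show "disjnt c d"
      using right_coset_eq_iff[OF assms(1)] unfolding disjnt_iff by (metis imageE)
  qed
qed (use assms(2) open_right_coset in auto)

section \<open>The walk on the right cosets\<close>

lemma walk_cong:
  "(\<And>i. 1 \<le> i \<Longrightarrow> i \<le> n \<Longrightarrow> X i \<omega> = Y i \<omega>') \<Longrightarrow> walk X n \<omega> = walk Y n \<omega>'"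
  by (induction n) auto

lemma measurable_walk:
  fixes X :: "nat \<Rightarrow> 'w \<Rightarrow> 'g::{topological_monoid_add, second_countable_topology}"
  assumes "\<And>i. 1 \<le> i \<Longrightarrow> i \<le> n \<Longrightarrow> X i \<in> borel_measurable M"
  shows "walk X n \<in> borel_measurable M"
  using assms
proof (induction n)
  case (Suc n)
  have "walk X (Suc n) = (\<lambda>\<omega>. walk X n \<omega> + X (Suc n) \<omega>)" by auto
  then show ?case using Suc by simp
qed (simp add: walk.simps(1)[abs_def])

locale subgroup_walk = prob_space P
  for P :: "'w measure" +
  fixes \<mu> :: "'g::{topological_group_add, second_countable_topology} measure"
    and H :: "'g set"
    and X :: "nat \<Rightarrow> 'w \<Rightarrow> 'g"
  assumes prob_\<mu>: "prob_space \<mu>" and sets_\<mu> [measurable_cong]: "sets \<mu> = sets borel"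
    and subgroup: "is_subgroup H" and open_H: "open H"
    and iid: "iid_with_law P X \<mu>"
begin

abbreviation cosets :: "'g set set" where
  "cosets \<equiv> range (right_coset H)"

lemmas countable_cosets = countable_right_cosets[OF subgroup open_H]

lemma step_measurable: "1 \<le> i \<Longrightarrow> X i \<in> borel_measurable P"
  using iid by (auto simp: iid_with_law_def indep_vars_def)

lemma walk_measurable [measurable]: "walk X n \<in> borel_measurable P"
  by (intro measurable_walk step_measurable)

lemma coset_sets [measurable]: "right_coset H g \<in> sets borel"
  using open_right_coset[OF open_H] by simp

lemma H_sets [measurable]: "H \<in> sets borel"
  using open_H by simp

section \<open>Transition and taboo probabilities of the coset chain\<close>

definition rep :: "'g set \<Rightarrow> 'g" where
  "rep c = (SOME g. right_coset H g = c)"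

lemma right_coset_rep: "c \<in> cosets \<Longrightarrow> right_coset H (rep c) = c"
  unfolding rep_def by (rule someI_ex) auto

text \<open>By \<open>right_coset_add\<close> the event is the same for every representative of the
  coset \<open>d\<close>.\<close>

definition trans_prob :: "'g set \<Rightarrow> 'g set \<Rightarrow> ennreal" where
  "trans_prob d c = emeasure \<mu> {s. right_coset H (rep d + s) = c}"

text \<open>Time 0 is left out, since the walk starts in \<open>H\<close>; hence
  \<open>no_return 0\<close> is the whole space.\<close>

definition no_return :: "nat \<Rightarrow> 'w set" where
  "no_return n = {\<omega>\<in>space P. \<forall>k\<in>{1..n}. walk X k \<omega> \<notin> H}"

text \<open>The taboo probabilities of the chain; their sum over \<open>n\<close> is the expected
  number of visits to \<open>c\<close> before the first return.\<close>

definition taboo :: "nat \<Rightarrow> 'g set \<Rightarrow> ennreal" where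
  "taboo n c = emeasure P {\<omega>\<in>no_return n. right_coset H (walk X n \<omega>) = c}"

text \<open>Openness gives measurability of the transition events and lets the support of \<mu>
  detect transitions of positive probability.\<close>

lemma step_open: "open {s. right_coset H (x + s) = right_coset H y}"
proof -
  have "open ((\<lambda>s. x + s) -` right_coset H y)"
    by (intro open_vimage continuous_intros open_right_coset open_H)
  then show ?thesis by (simp add: vimage_def right_coset_eq_iff[OF subgroup])
qed

lemma no_return_sets [measurable]: "no_return n \<in> sets P"
  unfolding no_return_def by measurable

lemma coset_event_sets [measurable]:
  assumes "c \<in> cosets"
  shows "{\<omega>\<in>no_return n. right_coset H (walk X m \<omega>) = c} \<in> sets P"
proof -
  obtain g where "c = right_coset H g" using assms by auto
  then have "{\<omega>\<in>no_return n. right_coset H (walk X m \<omega>) = c} =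
      no_return n \<inter> (walk X m -` right_coset H g \<inter> space P)"
    by (auto simp: right_coset_eq_iff[OF subgroup] no_return_def)
  also have "\<dots> \<in> sets P" by measurable
  finally show ?thesis .
qed

section \<open>Markov property, column sums and the recursion for the taboo probabilities\<close>

text \<open>The history up to time \<open>n\<close> is a function of the steps 1 to
  \<open>n\<close>, hence independent of step \<open>Suc n\<close>.\<close>

lemma emeasure_history_step:
  assumes d: "d \<in> cosets" and B: "B \<in> sets borel"
  shows "emeasure P {\<omega>\<in>no_return n. right_coset H (walk X n \<omega>) = d \<and> X (Suc n) \<omega> \<in> B} =
    taboo n d * emeasure \<mu> B"
proof -
  obtain g where g: "d = right_coset H g" using d by auto
  let ?A = "{1..n}" and ?B = "{Suc n}"
  \<comment> \<open>The walk as a function of the step sequence \<open>f\<close> itself, which turns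
    the history event into a measurable set \<open>SA\<close> of a product space.\<close>
  let ?W = "walk (\<lambda>i (f :: nat \<Rightarrow> 'g). f i)"
  let ?MA = "PiM ?A (\<lambda>_. borel :: 'g measure)"
  let ?MB = "PiM ?B (\<lambda>_. borel :: 'g measure)"
  define SA where "SA = {f\<in>space ?MA. (\<forall>k\<in>{1..n}. ?W k f \<notin> H) \<and> ?W n f \<in> right_coset H g}"
  define SB where "SB = {f\<in>space ?MB. f (Suc n) \<in> B}"
  have indep: "indep_var ?MA (\<lambda>\<omega>. restrict (\<lambda>i. X i \<omega>) ?A) ?MB (\<lambda>\<omega>. restrict (\<lambda>i. X i \<omega>) ?B)"
    using iid by (intro indep_var_restrict[of _ _ "{1..}"]) (auto simp: iid_with_law_def)
  have W: "?W k \<in> borel_measurable ?MA" if "k \<le> n" for k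
    using that by (intro measurable_walk measurable_component_singleton) auto
  have SA: "SA \<in> sets ?MA"
    unfolding SA_def using W by measurable
  have SB: "SB \<in> sets ?MB"
    unfolding SB_def using B by measurable
  have W_eq: "?W k (restrict (\<lambda>i. X i \<omega>) ?A) = walk X k \<omega>" if "k \<le> n" for k \<omega>
    using that by (intro walk_cong) auto
  have A_eq: "(\<lambda>\<omega>. restrict (\<lambda>i. X i \<omega>) ?A) -` SA \<inter> space P =
      {\<omega>\<in>no_return n. right_coset H (walk X n \<omega>) = d}"
  proof -
    have "(\<forall>k\<in>{1..n}. ?W k (restrict (\<lambda>i. X i \<omega>) ?A) \<notin> H) \<longleftrightarrow> (\<forall>k\<in>{1..n}. walk X k \<omega> \<notin> H)" for \<omega>
      by (intro ball_cong) (simp_all add: W_eq del: One_nat_def)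
    then show ?thesis
      by (auto simp: SA_def W_eq space_PiM no_return_def g right_coset_eq_iff[OF subgroup]
          simp del: One_nat_def)
  qed
  have B_eq: "(\<lambda>\<omega>. restrict (\<lambda>i. X i \<omega>) ?B) -` SB \<inter> space P = X (Suc n) -` B \<inter> space P"
    by (auto simp: SB_def space_PiM)
  have "emeasure \<mu> B = emeasure P (X (Suc n) -` B \<inter> space P)"
    using iid B step_measurable[of "Suc n"]
    by (auto simp: iid_with_law_def emeasure_distr[symmetric])
  moreover have "{\<omega>\<in>no_return n. right_coset H (walk X n \<omega>) = d \<and> X (Suc n) \<omega> \<in> B} =
      (\<lambda>x. (restrict (\<lambda>i. X i x) ?A, restrict (\<lambda>i. X i x) ?B)) -` (SA \<times> SB) \<inter> space P"
    using A_eq B_eq by blast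
  ultimately show ?thesis
    using indep_varD[OF indep SA SB] unfolding A_eq B_eq
    by (simp add: emeasure_eq_measure taboo_def ennreal_mult)
qed

text \<open>The event is split by the coset at time \<open>n\<close>. Avoidance is imposed only up
  to time \<open>n\<close>, so \<open>c = H\<close> is allowed and yields the first-return
  probabilities.\<close>

lemma emeasure_no_return_step:
  assumes c: "c \<in> cosets"
  shows "emeasure P {\<omega>\<in>no_return n. right_coset H (walk X (Suc n) \<omega>) = c} =
    (\<integral>\<^sup>+d. taboo n d * trans_prob d c \<partial>count_space cosets)"
proof -
  obtain g where g: "c = right_coset H g" using c by auto
  define E where "E d = {\<omega>\<in>no_return n. right_coset H (walk X n \<omega>) = d \<and>
    X (Suc n) \<omega> \<in> {s. right_coset H (rep d + s) = c}}" for d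
  have E_eq: "E d = {\<omega>\<in>no_return n. right_coset H (walk X n \<omega>) = d} \<inter>
      {\<omega>\<in>no_return n. right_coset H (walk X (Suc n) \<omega>) = c}" if "d \<in> cosets" for d
    using right_coset_add[OF subgroup, of "rep d"] right_coset_rep[OF that]
    by (auto simp: E_def)
  have "emeasure P {\<omega>\<in>no_return n. right_coset H (walk X (Suc n) \<omega>) = c} = emeasure P (\<Union>(E ` cosets))"
    by (rule arg_cong[where f = "emeasure P"]) (auto simp: E_eq)
  also have "\<dots> = (\<integral>\<^sup>+d. emeasure P (E d) \<partial>count_space cosets)"
  proof (rule emeasure_UN_countable[OF _ countable_cosets])
    show "E d \<in> sets P" if "d \<in> cosets" for d
      using that c by (simp only: E_eq) (intro sets.Int coset_event_sets)
    show "disjoint_family_on E cosets"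
      by (auto simp: disjoint_family_on_def E_def)
  qed
  also have "\<dots> = (\<integral>\<^sup>+d. taboo n d * trans_prob d c \<partial>count_space cosets)"
    unfolding E_def trans_prob_def g using step_open
    by (intro nn_integral_cong emeasure_history_step) auto
  finally show ?thesis .
qed

text \<open>Invariance of counting measure; it needs right cosets, as the steps multiply on the right.\<close>

lemma trans_prob_column:
  assumes c: "c \<in> cosets"
  shows "(\<integral>\<^sup>+d. trans_prob d c \<partial>count_space cosets) = 1"
proof -
  obtain g where g: "c = right_coset H g" using c by auto
  \<comment> \<open>For each step \<open>s\<close> exactly one coset leads to \<open>c\<close>, so
    the events indexed by \<open>d\<close> partition the group.\<close>
  have eq: "right_coset H (rep d + s) = c \<longleftrightarrow> d = right_coset H (g - s)" if "d \<in> cosets" for d s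
    using right_coset_add[OF subgroup, of "rep d + s" g "- s"]
      right_coset_add[OF subgroup, of "rep d" "g - s" s] right_coset_rep[OF that]
    by (auto simp: g add.assoc)
  have "(\<integral>\<^sup>+d. trans_prob d c \<partial>count_space cosets) =
      emeasure \<mu> (\<Union>d\<in>cosets. {s. right_coset H (rep d + s) = c})"
    unfolding trans_prob_def
  proof (rule emeasure_UN_countable[OF _ countable_cosets, symmetric])
    show "{s. right_coset H (rep d + s) = c} \<in> sets \<mu>" for d
      using step_open by (simp add: g sets_\<mu>)
    show "disjoint_family_on (\<lambda>d. {s. right_coset H (rep d + s) = c}) cosets"
      unfolding disjoint_family_on_def
    proof (intro ballI impI)
      fix d d' assume d: "d \<in> cosets" "d' \<in> cosets" "d \<noteq> d'"
      then show "{s. right_coset H (rep d + s) = c} \<inter> {s. right_coset H (rep d' + s) = c} = {}"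
        by (simp add: disjoint_iff eq) metis
    qed
  qed
  also have "(\<Union>d\<in>cosets. {s. right_coset H (rep d + s) = c}) = space \<mu>"
  proof -
    have "right_coset H (rep (right_coset H (g - s)) + s) = c" for s
      by (simp add: eq)
    then show ?thesis
      using sets_eq_imp_space_eq[OF sets_\<mu>] by (simp add: set_eq_iff) blast
  qed
  finally show ?thesis
    using prob_space.emeasure_space_1[OF prob_\<mu>] by simp
qed

lemma taboo_0: "taboo 0 c = (if c = H then 1 else 0)"
  using emeasure_space_1 by (auto simp: taboo_def no_return_def)

text \<open>Being in a coset other than \<open>H\<close> at time \<open>Suc n\<close> already
  implies avoidance at that time; for \<open>c = H\<close> the event is empty.\<close>

lemma taboo_Suc:
  assumes c: "c \<in> cosets"
  shows "taboo (Suc n) c =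
    (if c = H then 0 else \<integral>\<^sup>+d. taboo n d * trans_prob d c \<partial>count_space cosets)"
proof (cases "c = H")
  case True
  then have "{\<omega>\<in>no_return (Suc n). right_coset H (walk X (Suc n) \<omega>) = c} = {}"
    by (auto simp: no_return_def right_coset_eq_self_iff[OF subgroup] simp del: walk.simps)
  then have "taboo (Suc n) c = 0"
    unfolding taboo_def by (simp only: emeasure_empty)
  then show ?thesis using True by simp
next
  case False
  then have "{\<omega>\<in>no_return (Suc n). right_coset H (walk X (Suc n) \<omega>) = c} =
      {\<omega>\<in>no_return n. right_coset H (walk X (Suc n) \<omega>) = c}"
    using right_coset_eq_self_iff[OF subgroup]
    by (auto simp: no_return_def atLeastAtMostSuc_conv simp del: walk.simps)
  then show ?thesis
    using False emeasure_no_return_step[OF c] by (simp add: taboo_def del: walk.simps)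
qed

section \<open>Recurrence and irreducibility of the coset chain\<close>

lemma taboo_return:
  assumes "recurrent P X H"
  shows "(\<integral>\<^sup>+d. (\<Sum>n. taboo n d) * trans_prob d H \<partial>count_space cosets) = 1"
proof -
  have H: "H \<in> cosets" by (rule range_eqI[of _ _ 0]) simp
  \<comment> \<open>\<open>F n\<close> says that the first return happens at time
    \<open>Suc n\<close>; these events are disjoint, and by recurrence they cover almost
    everything.\<close>
  define F where "F n = {\<omega>\<in>no_return n. right_coset H (walk X (Suc n) \<omega>) = H}" for n
  have F_eq: "F n = {\<omega>\<in>no_return n. walk X (Suc n) \<omega> \<in> H}" for n
    by (simp only: F_def right_coset_eq_self_iff[OF subgroup])
  have F_disj: "F m \<inter> F n = {}" if "m < n" for m n
  proof -
    have "Suc m \<in> {1..n}" using that by auto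
    then show ?thesis unfolding F_eq no_return_def by blast
  qed
  have "(\<integral>\<^sup>+d. (\<Sum>n. taboo n d) * trans_prob d H \<partial>count_space cosets) = (\<Sum>n. emeasure P (F n))"
    unfolding F_def emeasure_no_return_step[OF H]
    by (subst nn_integral_suminf[symmetric]) simp_all
  also have "\<dots> = emeasure P (\<Union>n. F n)"
  proof (rule suminf_emeasure)
    show "range F \<subseteq> sets P"
      unfolding F_def using coset_event_sets[OF H] by blast
    show "disjoint_family F"
      unfolding disjoint_family_on_def using F_disj
      by (metis Int_commute linorder_neqE_nat)
  qed
  also have "\<dots> = emeasure P (space P)"
  proof (rule emeasure_eq_AE)
    have in_F: "\<omega> \<in> (\<Union>n. F n)" if "\<omega> \<in> space P" "\<exists>n\<ge>1. walk X n \<omega> \<in> H" for \<omega>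
    proof -
      define n where "n = (LEAST n. n \<ge> 1 \<and> walk X n \<omega> \<in> H)"
      have n: "n \<ge> 1" "walk X n \<omega> \<in> H"
        using LeastI_ex[of "\<lambda>n. n \<ge> 1 \<and> walk X n \<omega> \<in> H"] that(2) by (auto simp: n_def)
      have "walk X k \<omega> \<notin> H" if "1 \<le> k" "k < n" for k
        using not_less_Least[of k "\<lambda>n. n \<ge> 1 \<and> walk X n \<omega> \<in> H"] that by (auto simp: n_def)
      then have "\<omega> \<in> F (n - 1)"
        using n that(1) by (auto simp: F_eq no_return_def simp del: walk.simps)
      then show ?thesis by blast
    qed
    show "AE \<omega> in P. \<omega> \<in> (\<Union>n. F n) \<longleftrightarrow> \<omega> \<in> space P"
      using assms[unfolded recurrent_def]
      by (rule AE_mp) (rule AE_I2, use in_F in blast)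
    show "(\<Union>n. F n) \<in> sets P"
      unfolding F_def using coset_event_sets[OF H] by blast
  qed simp
  finally show ?thesis by (simp add: emeasure_space_1)
qed

lemma cosets_irreducible:
  assumes gen: "generating \<mu>" and D: "D \<subseteq> cosets" "H \<in> D"
    and closed: "\<And>x y. x \<in> cosets \<Longrightarrow> y \<in> D \<Longrightarrow> trans_prob x y > 0 \<Longrightarrow> x \<in> D"
  shows "D = cosets"
proof -
  have step: "right_coset H (y - s) \<in> D" if s: "s \<in> measure_support \<mu>" and y: "right_coset H y \<in> D" for s y
  proof (rule closed[OF _ y])
    let ?r = "rep (right_coset H (y - s))"
    have "right_coset H (?r + s) = right_coset H y"
      using right_coset_add[OF subgroup, of ?r "y - s" s] right_coset_rep[of "right_coset H (y - s)"]
      by simp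
    \<comment> \<open>The set of steps from the first coset to the second is open and contains
      \<open>s\<close>, so it has positive mass by definition of the support.\<close>
    then show "trans_prob (right_coset H (y - s)) (right_coset H y) > 0"
      using s step_open unfolding trans_prob_def measure_support_def by auto
  qed simp
  have backward: "right_coset H y \<in> D \<Longrightarrow> right_coset H (y - s) \<in> D"
    if "s \<in> generated_semigroup (measure_support \<mu>)" for s y
    using that
  proof (induction arbitrary: y)
    case (mult a b)
    \<comment> \<open>Going backwards reverses the order: the last factor \<open>b\<close> is
      removed first.\<close>
    have "y - (a + b) = y - b - a"
      by (rule diff_add_eq_diff_diff_swap)
    then show ?case using mult by simp
  qed (rule step)
  \<comment> \<open>Starting from \<open>H\<close>, the coset of 0, going back by the semigroup
    element \<open>- g\<close> leads to the coset of \<open>g\<close>.\<close>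
  have "right_coset H g \<in> D" for g
    using backward[of "- g" 0] gen D(2) by (simp add: generating_def)
  then show ?thesis using D(1) by auto
qed

lemma taboo_sum:
  assumes "recurrent P X H" and "generating \<mu>" and "c \<in> cosets"
  shows "(\<Sum>n. taboo n c) = 1"
proof (rule taboo_occupation_eq_1)
  show "H \<in> cosets" by (rule range_eqI[of _ _ 0]) simp
  show "taboo 0 y = (if y = H then 1 else 0)" for y by (rule taboo_0)
qed (fact trans_prob_column taboo_Suc taboo_return[OF assms(1)]
  cosets_irreducible[OF assms(2)] assms(3))+

section \<open>The expected return time as a sum of tail probabilities\<close>

lemma emeasure_no_return:
  "emeasure P (no_return n) = (\<integral>\<^sup>+c. taboo n c \<partial>count_space cosets)"
proof -
  have "emeasure P (no_return n) =
      emeasure P (\<Union>c\<in>cosets. {\<omega>\<in>no_return n. right_coset H (walk X n \<omega>) = c})"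
    by (rule arg_cong[where f = "emeasure P"]) auto
  also have "\<dots> = (\<integral>\<^sup>+c. taboo n c \<partial>count_space cosets)"
    unfolding taboo_def
    by (rule emeasure_UN_countable[OF coset_event_sets countable_cosets])
      (auto simp: disjoint_family_on_def)
  finally show ?thesis .
qed

text \<open>The expectation is the sum of the probabilities that the return time exceeds
  \<open>n\<close>. Splitting each by the coset at time \<open>n\<close> and exchanging the sums
  leaves a contribution of 1 from each coset.\<close>

lemma expected_return_time:
  assumes "recurrent P X H" and "generating \<mu>"
  shows "(\<integral>\<^sup>+ \<omega>. of_nat (return_time X H \<omega>) \<partial>P) = subgroup_index H"
proof -
  have [measurable]: "return_time X H \<in> measurable P (count_space UNIV)"
    unfolding return_time_def by measurable
  have "(\<integral>\<^sup>+ \<omega>. of_nat (return_time X H \<omega>) \<partial>P) =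
      (\<Sum>n. emeasure P {\<omega>\<in>space P. n < return_time X H \<omega>})"
    by (rule nn_integral_nat_function) measurable
  also have "\<dots> = (\<Sum>n. emeasure P (no_return n))"
  proof (intro suminf_cong emeasure_eq_AE)
    fix n
    \<comment> \<open>Restricted to paths that return, because otherwise \<open>return_time\<close>
      is unspecified; recurrence makes the other paths a null set.\<close>
    have less_iff: "n < return_time X H \<omega> \<longleftrightarrow> \<omega> \<in> no_return n"
      if "\<omega> \<in> space P" and ex: "\<exists>n\<ge>1. walk X n \<omega> \<in> H" for \<omega>
    proof -
      let ?Q = "\<lambda>n. n \<ge> 1 \<and> walk X n \<omega> \<in> H"
      have "?Q (return_time X H \<omega>)"
        unfolding return_time_def using ex by (rule LeastI_ex)
      moreover have "\<not> ?Q k" if "k < return_time X H \<omega>" for k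
        using that unfolding return_time_def by (rule not_less_Least)
      ultimately show ?thesis
        using that(1) unfolding no_return_def by (force simp: not_less simp del: walk.simps)
    qed
    show "AE \<omega> in P. \<omega> \<in> {\<omega>\<in>space P. n < return_time X H \<omega>} \<longleftrightarrow> \<omega> \<in> no_return n"
      using assms(1)[unfolded recurrent_def]
      by (rule AE_mp) (rule AE_I2, use less_iff in blast)
  qed measurable
  also have "\<dots> = (\<integral>\<^sup>+c. (\<Sum>n. taboo n c) \<partial>count_space cosets)"
    by (simp add: emeasure_no_return nn_integral_suminf)
  also have "\<dots> = (\<integral>\<^sup>+c. 1 \<partial>count_space cosets)"
    using taboo_sum[OF assms] by (intro nn_integral_cong) auto
  also have "\<dots> = subgroup_index H"
    by (simp add: subgroup_index_eq_right_cosets[OF subgroup] emeasure_count_space)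
  finally show ?thesis .
qed

end

theorem theorem1p2:
  fixes \<mu> :: "'g::{topological_group_add, second_countable_topology} measure"
    and \<Gamma> :: "'g set"
    and P :: "'w measure"
    and X :: "nat \<Rightarrow> 'w \<Rightarrow> 'g"
  assumes "prob_space \<mu>" and "sets \<mu> = sets borel" and "generating \<mu>"
    and "is_subgroup \<Gamma>" and "open \<Gamma>"
    and "prob_space P" and "iid_with_law P X \<mu>"
    and "recurrent P X \<Gamma>"
  shows "(\<integral>\<^sup>+ \<omega>. of_nat (return_time X \<Gamma> \<omega>) \<partial>P) = subgroup_index \<Gamma>"
proof -
  interpret subgroup_walk P \<mu> \<Gamma> X
    by (intro subgroup_walk.intro subgroup_walk_axioms.intro) fact+
  show ?thesis by (rule expected_return_time) fact+
qed

end
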